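(* Let $n \geq 2$. Then $m_n = \frac{1}{n-1}$; that is, the smallest modulus of a reliability root of a connected graph of order $n$ is $\frac{1}{n-1}$.
   Context: All graphs are finite, undirected and connected, possibly with loops and/or multiple edges. The order of a graph is its number of vertices. For a connected graph $G$ with vertex set $V$ and edge (multi)set $E$, the (all-terminal) reliability of $G$ is the probability that the operational edges form a connected spanning subgraph, when vertices always operate and each edge fails independently with probability $q$. It is the polynomial $\mathrm{Rel}(G,q) = \sum_{S} (1-q)^{|S|} q^{|E|-|S|}$, where the sum is over all $S \subseteq E$ such that the spanning subgraph $(V,S)$ is connected. A reliability root of $G$ is a complex number $z$ with $\mathrm{Rel}(G,z)=0$. For $n \ge 2$, $m_n$ denotes the minimum modulus $|z|$ of a reliability root $z$ over all connected graphs of order $n$ (with any number of edges). *)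

theory Defs
  imports
    "HOL-Analysis.Analysis"
    "HOL-Library.Uprod"
    "HOL-Computational_Algebra.Polynomial"
begin

text \<open>
  Undirected multigraphs. Each edge name carries an unordered pair of endpoints: a loop at
  \<open>v\<close> has endpoints \<open>Upair v v\<close>, and parallel edges are different names with the same endpoints.
\<close>

record ('v, 'e) multigraph =
  verts :: "'v set"
  edges :: "'e set"
  ends :: "'e \<Rightarrow> 'v uprod"

definition finite_multigraph :: "('v, 'e) multigraph \<Rightarrow> bool" where
  "finite_multigraph G \<longleftrightarrow>
     finite (verts G) \<and> finite (edges G) \<and> (\<forall>e\<in>edges G. set_uprod (ends G e) \<subseteq> verts G)"

definition graph_order :: "('v, 'e) multigraph \<Rightarrow> nat" where
  "graph_order G = card (verts G)"

definition adj_rel :: "('v, 'e) multigraph \<Rightarrow> ('v \<times> 'v) set" where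
  "adj_rel G = {(u, v). \<exists>e\<in>edges G. ends G e = Upair u v}"

definition connected_multigraph :: "('v, 'e) multigraph \<Rightarrow> bool" where
  "connected_multigraph G \<longleftrightarrow>
     verts G \<noteq> {} \<and> (\<forall>u\<in>verts G. \<forall>v\<in>verts G. (u, v) \<in> (adj_rel G)\<^sup>*)"

definition spanning_subgraph :: "('v, 'e) multigraph \<Rightarrow> 'e set \<Rightarrow> ('v, 'e) multigraph" where
  "spanning_subgraph G S = G\<lparr>edges := S\<rparr>"

text \<open>
  The reliability as a polynomial in the edge failure probability \<open>q\<close>;
  \<open>[:1, -1:]\<close> is \<open>1 - q\<close> and \<open>[:0, 1:]\<close> is \<open>q\<close>.
\<close>

definition reliability_poly :: "('v, 'e) multigraph \<Rightarrow> complex poly" where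
  "reliability_poly G =
     (\<Sum>S | S \<subseteq> edges G \<and> connected_multigraph (spanning_subgraph G S).
        [:1, -1:] ^ card S * [:0, 1:] ^ (card (edges G) - card S))"

definition reliability_root :: "('v, 'e) multigraph \<Rightarrow> complex \<Rightarrow> bool" where
  "reliability_root G z \<longleftrightarrow> poly (reliability_poly G) z = 0"

text \<open>
  The moduli of reliability roots of connected graphs of order \<open>n\<close>. Every finite multigraph is
  isomorphic to one whose vertices and edge names are natural numbers, so these represent all
  graphs.
\<close>

definition root_moduli :: "nat \<Rightarrow> real set" where
  "root_moduli n =
     {cmod z | z. \<exists>G :: (nat, nat) multigraph.
        finite_multigraph G \<and> connected_multigraph G \<and> graph_order G = n \<and> reliability_root G z}"

text \<open>
  \<open>LEAST\<close> on the reals is the minimum only if the minimum is attained; otherwise its value is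
  unspecified.
\<close>

definition min_root_modulus :: "nat \<Rightarrow> real" where
  "min_root_modulus n = (LEAST r. r \<in> root_moduli n)"

end

theory Submission
  imports Defs
begin

text \<open>
  For a graph \<open>G\<close> of order \<open>n\<close> the reliability factors as \<open>Rel(G, q) = (1 - q)\<^sup>n\<^sup>-\<^sup>1 h(q)\<close>,
  and the coefficients of \<open>h\<close> are nonnegative and satisfy \<open>h\<^sub>i\<^sub>+\<^sub>1 \<le> (n - 1) h\<^sub>i\<close>. (For connected
  \<open>G\<close> they form the \<open>h\<close>-vector of the cographic matroid.) Both facts come from one induction on the
  number of edges: if \<open>e\<close> is not a loop, then
  \<open>Rel(G) = q Rel(G - e) + (1 - q) Rel(G / e)\<close>, and \<open>G / e\<close> has order \<open>n - 1\<close>, so that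
  \<open>h(G) = q h(G - e) + h(G / e)\<close>. In
  \<open>h\<^sub>i\<^sub>+\<^sub>1(G) = h\<^sub>i(G - e) + h\<^sub>i\<^sub>+\<^sub>1(G / e)\<close>
  the first summand is at most \<open>(n - 1) h\<^sub>i\<^sub>-\<^sub>1(G - e)\<close> and the second at most
  \<open>(n - 2) h\<^sub>i(G / e)\<close>, which together do not exceed \<open>(n - 1) h\<^sub>i(G)\<close>. At \<open>i = 0\<close> the term
  \<open>h\<^sub>i\<^sub>-\<^sub>1\<close> is missing, and the one spare copy of \<open>h\<^sub>0(G / e)\<close> pays for \<open>h\<^sub>0(G - e)\<close>: the constant
  coefficient is 1 or 0 according to whether the graph is connected, and \<open>G / e\<close> is connected
  whenever \<open>G - e\<close> is. This is \<open>reliability_factorization\<close>.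

  An argument in the manner of Enestrom and Kakeya (\<open>geometric_growth_poly_nonzero\<close>) then shows
  that \<open>h\<close> has no zero of modulus less than \<open>1 / (n - 1)\<close> if \<open>G\<close> is connected. The other
  factor of the reliability vanishes only at \<open>q = 1\<close>.

  The bound is attained by the cycle of length \<open>n\<close>. A set of its edges is connected and spanning
  exactly if it misses at most one edge, which gives
  \<open>Rel = (1 - q)\<^sup>n + n q (1 - q)\<^sup>n\<^sup>-\<^sup>1 = (1 - q)\<^sup>n\<^sup>-\<^sup>1 (1 + (n - 1) q)\<close>, with the root
  \<open>-1 / (n - 1)\<close>.
\<close>

section \<open>Polynomials whose coefficients grow at most geometrically\<close>

definition geometric_growth :: "nat \<Rightarrow> complex poly \<Rightarrow> bool" where
  "geometric_growth k p \<longleftrightarrow>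
     (\<forall>i. coeff p i \<in> \<real>\<^sub>\<ge>\<^sub>0 \<and> of_nat k * coeff p i - coeff p (Suc i) \<in> \<real>\<^sub>\<ge>\<^sub>0)"

lemma cmod_poly_le_Re_poly_cmod:
  assumes "\<And>i. coeff p i \<in> \<real>\<^sub>\<ge>\<^sub>0"
  shows "cmod (poly p z) \<le> Re (poly p (of_real (cmod z)))"
proof -
  have c: "coeff p i = of_real (cmod (coeff p i))" for i
    using assms[of i] by (auto simp: nonneg_Reals_def)
  have "cmod (poly p z) \<le> (\<Sum>i\<le>degree p. cmod (coeff p i * z ^ i))"
    unfolding poly_altdef by (rule norm_sum)
  also have "\<dots> = (\<Sum>i\<le>degree p. Re (coeff p i * of_real (cmod z) ^ i))"
  proof (rule sum.cong[OF refl])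
    fix i
    have "coeff p i * of_real (cmod z) ^ i = of_real (cmod (coeff p i) * cmod z ^ i)"
      by (subst c) simp
    then show "cmod (coeff p i * z ^ i) = Re (coeff p i * of_real (cmod z) ^ i)"
      by (simp only: Re_complex_of_real norm_mult norm_power)
  qed
  finally show ?thesis
    unfolding poly_altdef by simp
qed

text \<open>
  Multiplying by \<open>k z - 1\<close> turns the growth condition into nonnegativity: the polynomial
  \<open>(k z - 1) p(z) + 1\<close> has nonnegative coefficients and is divisible by \<open>z\<close>. At a root of
  \<open>p\<close> its value is 1, so its value at \<open>\<bar>z\<bar>\<close> is at least 1. But that value is
  \<open>1 - (1 - k\<bar>z\<bar>) p(\<bar>z\<bar>)\<close>, which is less than 1 since \<open>p(\<bar>z\<bar>) \<ge> p(0) = 1\<close>.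
\<close>

lemma geometric_growth_poly_nonzero:
  assumes growth: "geometric_growth k p" and one: "coeff p 0 = 1" and small: "of_nat k * cmod z < 1"
  shows "poly p z \<noteq> 0"
proof
  assume root: "poly p z = 0"
  obtain r where p: "p = pCons 1 r"
    using one by (metis coeff_pCons_0 pCons_cases)
  define d where "d = smult (of_nat k) p - r"
  let ?m = "complex_of_real (cmod z)"
  have nonneg_d: "coeff d i \<in> \<real>\<^sub>\<ge>\<^sub>0" for i
  proof -
    have "coeff d i = of_nat k * coeff p i - coeff p (Suc i)"
      unfolding d_def coeff_diff coeff_smult by (simp add: p)
    then show ?thesis
      using growth by (simp add: geometric_growth_def)
  qed
  have "coeff r i \<in> \<real>\<^sub>\<ge>\<^sub>0" for i
    using growth by (metis geometric_growth_def p coeff_pCons_Suc)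
  then have "0 \<le> Re (poly r ?m)"
    using cmod_poly_le_Re_poly_cmod norm_ge_zero order_trans by blast
  then have p_ge_1: "1 \<le> Re (poly p ?m)"
    by (simp add: p)
  have d_eval: "x * poly d x = of_nat k * x * poly p x - poly p x + 1" for x
    by (simp add: d_def p algebra_simps)
  have "1 = cmod (z * poly d z)"
    using root by (simp add: d_eval)
  also have "\<dots> \<le> cmod z * Re (poly d ?m)"
    by (simp add: norm_mult mult_left_mono cmod_poly_le_Re_poly_cmod nonneg_d)
  also have "\<dots> = Re (?m * poly d ?m)"
    by simp
  also have "\<dots> = 1 - (1 - of_nat k * cmod z) * Re (poly p ?m)"
    unfolding d_eval by (simp add: algebra_simps)
  also have "\<dots> < 1"
  proof -
    have "0 < (1 - of_nat k * cmod z) * Re (poly p ?m)"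
      using small p_ge_1 by (intro mult_pos_pos) auto
    then show ?thesis by simp
  qed
  finally show False by simp
qed

text \<open>
  This is the step of the induction over deletion and contraction: \<open>p\<close> belongs to the contracted
  graph, whose order is smaller by one, and \<open>r\<close> to the graph without the edge. The last assumption
  is what the linear coefficient of \<open>q r + p\<close> needs, since there the constant coefficient of
  \<open>r\<close> has no predecessor to be compared with.
\<close>

lemma geometric_growth_pCons_add:
  assumes p: "geometric_growth k p" and r: "geometric_growth (Suc k) r"
    and le: "coeff p 0 - coeff r 0 \<in> \<real>\<^sub>\<ge>\<^sub>0"
  shows "geometric_growth (Suc k) (pCons 0 r + p)"
  unfolding geometric_growth_def
proof (intro allI)
  fix i
  show "coeff (pCons 0 r + p) i \<in> \<real>\<^sub>\<ge>\<^sub>0 \<and>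
        of_nat (Suc k) * coeff (pCons 0 r + p) i - coeff (pCons 0 r + p) (Suc i) \<in> \<real>\<^sub>\<ge>\<^sub>0"
  proof (cases i)
    case 0
    have "of_nat (Suc k) * coeff p 0 - (coeff r 0 + coeff p (Suc 0))
        = (of_nat k * coeff p 0 - coeff p (Suc 0)) + (coeff p 0 - coeff r 0)"
      by (simp add: algebra_simps)
    also have "\<dots> \<in> \<real>\<^sub>\<ge>\<^sub>0"
      using p le by (intro nonneg_Reals_add_I) (auto simp: geometric_growth_def)
    finally show ?thesis
      using p 0 by (simp add: geometric_growth_def)
  next
    case (Suc j)
    have "of_nat (Suc k) * (coeff r j + coeff p (Suc j)) - (coeff r (Suc j) + coeff p (Suc (Suc j)))
        = (of_nat (Suc k) * coeff r j - coeff r (Suc j))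
          + ((of_nat k * coeff p (Suc j) - coeff p (Suc (Suc j))) + coeff p (Suc j))"
      by (simp add: algebra_simps)
    also have "\<dots> \<in> \<real>\<^sub>\<ge>\<^sub>0"
      using p r unfolding geometric_growth_def by (intro nonneg_Reals_add_I) blast+
    finally show ?thesis
      using p r Suc by (simp add: geometric_growth_def)
  qed
qed

section \<open>Deletion and contraction of an edge\<close>

definition delete_edge :: "('v, 'e) multigraph \<Rightarrow> 'e \<Rightarrow> ('v, 'e) multigraph" where
  "delete_edge G e = G\<lparr>edges := edges G - {e}\<rparr>"

text \<open>
  The endpoint \<open>v\<close> is merged into \<open>u\<close>, so the contraction keeps the vertex and edge types of \<open>G\<close>.
  Edges parallel to \<open>e\<close> become loops at \<open>u\<close>.
\<close>

definition contract_edge :: "('v, 'e) multigraph \<Rightarrow> 'e \<Rightarrow> 'v \<Rightarrow> 'v \<Rightarrow> ('v, 'e) multigraph" where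
  "contract_edge G e u v =
     \<lparr>verts = id(v := u) ` verts G, edges = edges G - {e}, ends = map_uprod (id(v := u)) \<circ> ends G\<rparr>"

lemma spanning_subgraph_simps [simp]:
  "verts (spanning_subgraph G S) = verts G" "edges (spanning_subgraph G S) = S"
  "ends (spanning_subgraph G S) = ends G"
  by (simp_all add: spanning_subgraph_def)

lemma spanning_subgraph_edges: "spanning_subgraph G (edges G) = G"
  by (simp add: spanning_subgraph_def)

lemma spanning_subgraph_delete_edge [simp]:
  "spanning_subgraph (delete_edge G e) S = spanning_subgraph G S"
  by (simp add: spanning_subgraph_def delete_edge_def)

lemma delete_edge_simps [simp]:
  "verts (delete_edge G e) = verts G" "edges (delete_edge G e) = edges G - {e}"
  "ends (delete_edge G e) = ends G"
  by (simp_all add: delete_edge_def)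

lemma contract_edge_simps [simp]:
  "verts (contract_edge G e u v) = id(v := u) ` verts G"
  "edges (contract_edge G e u v) = edges G - {e}"
  "ends (contract_edge G e u v) = map_uprod (id(v := u)) \<circ> ends G"
  by (simp_all add: contract_edge_def)

lemma contract_loop: "contract_edge G e u u = delete_edge G e"
proof -
  have "id(u := u) = (id :: 'a \<Rightarrow> 'a)" by auto
  then show ?thesis
    by (simp add: contract_edge_def delete_edge_def uprod.map_id0)
qed

lemma Upair_commute: "Upair u v = Upair v u"
  by simp

lemma sym_adj_rel: "sym (adj_rel G)"
  by (auto simp: sym_def adj_rel_def Upair_commute)

lemma connected_mono:
  assumes "connected_multigraph (spanning_subgraph G S)" "S \<subseteq> T"
  shows "connected_multigraph (spanning_subgraph G T)"
proof -
  have "adj_rel (spanning_subgraph G S) \<subseteq> adj_rel (spanning_subgraph G T)"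
    using assms(2) by (auto simp: adj_rel_def)
  from rtrancl_mono[OF this] show ?thesis
    using assms(1) by (auto simp: connected_multigraph_def)
qed

text \<open>
  Walks in \<open>G\<close> project to walks in the contraction, where a step along \<open>e\<close> becomes stationary.
  Conversely, a walk in the contraction lifts to \<open>G\<close> because every vertex either
  is its own representative or is joined to it by \<open>e\<close>.
\<close>

lemma connected_contract_iff:
  assumes e: "ends G e = Upair u v" and u: "u \<in> verts G"
  shows "connected_multigraph (spanning_subgraph (contract_edge G e u v) S)
     \<longleftrightarrow> connected_multigraph (spanning_subgraph G (insert e S))"
    (is "connected_multigraph ?C \<longleftrightarrow> connected_multigraph ?I")
proof -
  let ?f = "id(v := u)"
  have project: "(?f a, ?f b) \<in> (adj_rel ?C)\<^sup>*" if "(a, b) \<in> (adj_rel ?I)\<^sup>*" for a b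
    using that
  proof induction
    case (step b c)
    from step.hyps(2) obtain g where g: "g \<in> insert e S" "ends G g = Upair b c"
      by (auto simp: adj_rel_def)
    show ?case
    proof (cases "g = e")
      case True
      then have "?f b = ?f c" using g e by auto
      then show ?thesis using step.IH by (simp only:)
    next
      case False
      then have "(?f b, ?f c) \<in> adj_rel ?C"
        using g by (auto simp: adj_rel_def simp del: fun_upd_apply intro!: bexI[of _ g])
      then show ?thesis using step.IH by (rule rtrancl_into_rtrancl[rotated])
    qed
  qed simp
  have "(u, v) \<in> adj_rel ?I" "(v, u) \<in> adj_rel ?I"
    using e by (auto simp: adj_rel_def Upair_commute)
  then have to_rep: "(a, ?f a) \<in> (adj_rel ?I)\<^sup>*" and from_rep: "(?f a, a) \<in> (adj_rel ?I)\<^sup>*" for a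
    by auto
  have lift: "(a, b) \<in> (adj_rel ?I)\<^sup>*" if "(a, b) \<in> (adj_rel ?C)\<^sup>*" for a b
    using that
  proof induction
    case (step b c)
    from step.hyps(2) obtain g where g: "g \<in> S" "map_uprod ?f (ends G g) = Upair b c"
      by (auto simp: adj_rel_def)
    obtain x y where xy: "ends G g = Upair x y"
      by (cases "ends G g") auto
    have adj: "(x, y) \<in> adj_rel ?I" "(y, x) \<in> adj_rel ?I"
      using g xy by (auto simp: adj_rel_def Upair_commute)
    from g xy have "b = ?f x \<and> c = ?f y \<or> b = ?f y \<and> c = ?f x"
      by (auto simp del: fun_upd_apply)
    then have "(b, c) \<in> (adj_rel ?I)\<^sup>*"
      using adj to_rep from_rep by (meson rtrancl_into_rtrancl rtrancl_trans)
    then show ?case using step.IH by (rule rtrancl_trans[rotated])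
  qed simp
  show ?thesis
  proof
    assume "connected_multigraph ?C"
    then have ne: "verts G \<noteq> {}"
      and conn: "\<And>a b. a \<in> verts G \<Longrightarrow> b \<in> verts G \<Longrightarrow> (?f a, ?f b) \<in> (adj_rel ?C)\<^sup>*"
      unfolding connected_multigraph_def by (auto simp del: fun_upd_apply)
    have "(a, b) \<in> (adj_rel ?I)\<^sup>*" if "a \<in> verts G" "b \<in> verts G" for a b
      using to_rep lift[OF conn[OF that]] from_rep by (meson rtrancl_trans)
    then show "connected_multigraph ?I"
      using ne by (simp add: connected_multigraph_def)
  next
    assume "connected_multigraph ?I"
    then show "connected_multigraph ?C"
      using project unfolding connected_multigraph_def by (auto simp del: fun_upd_apply)
  qed
qed

text \<open>
  This conditions on the state of \<open>e\<close>. It holds for loops as well, where both summands on the right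
  involve the reliability of the same graph.
\<close>

lemma reliability_deletion_contraction:
  assumes fin: "finite (edges G)" and e: "e \<in> edges G" "ends G e = Upair u v" and u: "u \<in> verts G"
  shows "reliability_poly G =
    [:0, 1:] * reliability_poly (delete_edge G e)
    + [:1, -1:] * reliability_poly (contract_edge G e u v)"
proof -
  define E where "E = edges G - {e}"
  have E: "edges G = insert e E" "e \<notin> E" "finite E"
    using e fin by (auto simp: E_def)
  let ?conn = "\<lambda>S. connected_multigraph (spanning_subgraph G S)"
  let ?t = "\<lambda>S. [:1, -1:] ^ card S * [:0, 1:] ^ (card (edges G) - card S) :: complex poly"
  let ?A = "{S. S \<subseteq> E \<and> ?conn S}" and ?B = "{S. S \<subseteq> E \<and> ?conn (insert e S)}"
  have card_le: "card S \<le> card E" "finite S" if "S \<subseteq> E" for S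
    using that E by (auto intro: card_mono finite_subset)
  have split: "{S. S \<subseteq> edges G \<and> ?conn S} = ?A \<union> insert e ` ?B"
  proof (intro set_eqI iffI)
    fix S assume S: "S \<in> {S. S \<subseteq> edges G \<and> ?conn S}"
    show "S \<in> ?A \<union> insert e ` ?B"
    proof (cases "e \<in> S")
      case True
      then have "S = insert e (S - {e})" by auto
      moreover have "S - {e} \<in> ?B"
        using S True E by (auto simp: insert_absorb)
      ultimately show ?thesis by blast
    qed (use S E in auto)
  qed (use E in auto)
  have "reliability_poly G = sum ?t ?A + sum ?t (insert e ` ?B)"
    unfolding reliability_poly_def split
    by (rule sum.union_disjoint) (use E in auto)
  also have "sum ?t ?A = [:0, 1:] * reliability_poly (delete_edge G e)"
    unfolding reliability_poly_def sum_distrib_left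
    by (rule sum.cong) (use E card_le in \<open>auto simp: E_def[symmetric] Suc_diff_le\<close>)
  also have "sum ?t (insert e ` ?B) = (\<Sum>S\<in>?B. ?t (insert e S))"
    by (rule sum.reindex[unfolded o_def]) (use E in \<open>auto intro!: inj_onI\<close>)
  also have "\<dots> = [:1, -1:] * reliability_poly (contract_edge G e u v)"
    unfolding reliability_poly_def sum_distrib_left connected_contract_iff[OF e(2) u]
  proof (rule sum.cong)
    fix S assume "S \<in> {S. S \<subseteq> edges (contract_edge G e u v) \<and> ?conn (insert e S)}"
    then have "S \<subseteq> E" by (auto simp: E_def)
    then have "card (insert e S) = Suc (card S)"
      using E card_le by (subst card_insert_disjoint) auto
    then show "?t (insert e S) = [:1, -1:] * ([:1, -1:] ^ card S *
        [:0, 1:] ^ (card (edges (contract_edge G e u v)) - card S))"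
      using E by (simp add: E_def[symmetric] del: mult_pCons_left)
  qed (auto simp: E_def)
  finally show ?thesis .
qed

section \<open>The cofactor of a power of \<open>1 - q\<close> in the reliability\<close>

lemma poly_reliability_0:
  assumes fin: "finite (edges G)"
  shows "poly (reliability_poly G) 0 = of_bool (connected_multigraph G)"
proof -
  let ?A = "{S. S \<subseteq> edges G \<and> connected_multigraph (spanning_subgraph G S)}"
  have "poly (reliability_poly G) 0 = (\<Sum>S\<in>?A. 0 ^ (card (edges G) - card S))"
    by (simp add: reliability_poly_def poly_sum poly_mult poly_power)
  also have "\<dots> = (\<Sum>S\<in>?A. of_bool (S = edges G))"
  proof (rule sum.cong[OF refl])
    fix S assume "S \<in> ?A"
    then have "S = edges G \<longleftrightarrow> \<not> card S < card (edges G)"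
      using fin by (metis (mono_tags, lifting) mem_Collect_eq psubsetI psubset_card_mono less_irrefl)
    then show "0 ^ (card (edges G) - card S) = (of_bool (S = edges G) :: complex)"
      by (auto simp: zero_power)
  qed
  also have "\<dots> = of_bool (connected_multigraph G)"
    using fin by (simp add: of_bool_def sum.delta spanning_subgraph_edges)
  finally show ?thesis .
qed

lemma reliability_cofactor_coeff_0:
  assumes "finite (edges G)" "reliability_poly G = [:1, -1:] ^ k * h"
  shows "coeff h 0 = of_bool (connected_multigraph G)"
proof -
  have "poly h 0 = of_bool (connected_multigraph G)"
    using poly_reliability_0[OF assms(1)] assms(2) by (simp add: poly_mult poly_power)
  then show ?thesis
    by (simp only: poly_0_coeff_0)
qed

lemma reliability_edgeless:
  assumes "edges G = {}"
  shows "reliability_poly G = of_bool (connected_multigraph G)"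
proof -
  have "spanning_subgraph G {} = G"
    using assms spanning_subgraph_edges[of G] by metis
  then have "connected_multigraph (spanning_subgraph G {}) \<longleftrightarrow> connected_multigraph G"
    by (rule arg_cong)
  then have "{S. S \<subseteq> edges G \<and> connected_multigraph (spanning_subgraph G S)}
      = (if connected_multigraph G then {{}} else {})"
    unfolding assms by auto
  then show ?thesis
    using assms by (simp add: reliability_poly_def)
qed

text \<open>
  Disconnected graphs are included, with reliability 0 and \<open>h = 0\<close>, so that bridges
  can be deleted without a case distinction. Loops are treated apart, since contracting one does
  not lower the order; but they do not affect the reliability.
\<close>

lemma reliability_factorization:
  fixes G :: "('v, 'e) multigraph"
  assumes "finite_multigraph G" "verts G \<noteq> {}"
  shows "\<exists>h. reliability_poly G = [:1, -1:] ^ (graph_order G - 1) * h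
    \<and> geometric_growth (graph_order G - 1) h"
  using assms
proof (induction "card (edges G)" arbitrary: G)
  case 0
  then have no_edges: "edges G = {}"
    by (simp add: finite_multigraph_def)
  show ?case
  proof (cases "connected_multigraph G")
    case True
    obtain a where a: "a \<in> verts G" using 0 by auto
    have "adj_rel G = {}" using no_edges by (auto simp: adj_rel_def)
    then have "verts G = {a}"
      using True a by (auto simp: connected_multigraph_def)
    moreover have "geometric_growth 0 1"
      by (auto simp: geometric_growth_def)
    ultimately show ?thesis
      using True no_edges by (intro exI[of _ 1]) (simp add: reliability_edgeless graph_order_def)
  next
    case False
    then show ?thesis
      using no_edges by (intro exI[of _ 0]) (simp add: reliability_edgeless geometric_growth_def)
  qed
next
  case (Suc m)
  have fin: "finite (edges G)" "finite (verts G)"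
    using Suc.prems by (auto simp: finite_multigraph_def)
  obtain e where e: "e \<in> edges G"
    using Suc.hyps(2) by fastforce
  have m: "m = card (edges G - {e})"
    using Suc.hyps(2) e fin by simp
  obtain u v where uv: "ends G e = Upair u v"
    by (cases "ends G e") auto
  have "set_uprod (ends G e) \<subseteq> verts G"
    using Suc.prems e by (auto simp: finite_multigraph_def)
  then have in_verts: "u \<in> verts G" "v \<in> verts G"
    by (auto simp: uv)
  let ?D = "delete_edge G e" and ?C = "contract_edge G e u v"
  note recursion = reliability_deletion_contraction[OF fin(1) e uv in_verts(1)]
  have "finite_multigraph ?D"
    using Suc.prems by (auto simp: finite_multigraph_def)
  then obtain h where h: "reliability_poly ?D = [:1, -1:] ^ (graph_order G - 1) * h"
      "geometric_growth (graph_order G - 1) h"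
    using Suc.hyps(1)[of ?D] m Suc.prems by (auto simp: graph_order_def)
  show ?case
  proof (cases "u = v")
    case True
    then have "reliability_poly G = reliability_poly ?D"
      using recursion by (simp add: contract_loop flip: distrib_right)
    then show ?thesis using h by auto
  next
    case False
    have verts_C: "verts ?C = verts G - {v}"
      using False in_verts by auto
    obtain k where k: "graph_order G = Suc (Suc k)" "graph_order ?C = Suc k"
    proof
      have "card {u, v} \<le> card (verts G)"
        using in_verts fin by (intro card_mono) auto
      then show "graph_order G = Suc (Suc (graph_order G - 2))"
        using False by (simp add: graph_order_def)
      then show "graph_order ?C = Suc (graph_order G - 2)"
        using in_verts fin unfolding graph_order_def verts_C by simp
    qed
    have "finite_multigraph ?C"
      using Suc.prems by (auto simp: finite_multigraph_def uprod.set_map simp del: fun_upd_apply)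
    then obtain g where g: "reliability_poly ?C = [:1, -1:] ^ k * g" "geometric_growth k g"
      using Suc.hyps(1)[of ?C] m Suc.prems k by auto
    (* The constant coefficients are comparable because contraction preserves more connectivity
       than deletion. *)
    have conn: "connected_multigraph ?C" if "connected_multigraph ?D"
    proof -
      have "connected_multigraph (spanning_subgraph G (edges G - {e}))"
        using that by (metis spanning_subgraph_edges spanning_subgraph_delete_edge delete_edge_simps(2))
      then have "connected_multigraph (spanning_subgraph G (insert e (edges G - {e})))"
        by (rule connected_mono) auto
      then show ?thesis
        using connected_contract_iff[OF uv in_verts(1), of "edges G - {e}"]
        by (metis spanning_subgraph_edges contract_edge_simps(2))
    qed
    have "coeff h 0 = of_bool (connected_multigraph ?D)"
      using reliability_cofactor_coeff_0[OF _ h(1)] fin by simp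
    moreover have "coeff g 0 = of_bool (connected_multigraph ?C)"
      using reliability_cofactor_coeff_0[OF _ g(1)] fin by simp
    ultimately have "coeff g 0 - coeff h 0 \<in> \<real>\<^sub>\<ge>\<^sub>0"
      using conn by auto
    then have "geometric_growth (Suc k) (pCons 0 h + g)"
      using geometric_growth_pCons_add g h k by simp
    moreover have "reliability_poly G = [:1, -1:] ^ Suc k * (pCons 0 h + g)"
    proof -
      have "pCons 0 h = [:0, 1:] * h" by simp
      then show ?thesis
        unfolding recursion h g k by (simp add: algebra_simps del: mult_pCons_left mult_pCons_right)
    qed
    ultimately show ?thesis using k by auto
  qed
qed

lemma reliability_root_modulus_ge:
  assumes fin: "finite_multigraph G" and conn: "connected_multigraph G"
    and order: "graph_order G = n" "n \<ge> 2" and root: "reliability_root G z"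
  shows "1 / (real n - 1) \<le> cmod z"
proof (rule ccontr)
  assume "\<not> 1 / (real n - 1) \<le> cmod z"
  then have small: "real (n - 1) * cmod z < 1"
    using order by (simp add: field_simps of_nat_diff)
  (* The factor (1 - q)^(n - 1) vanishes at 1 only, which is too large to be this root. *)
  have "1 * cmod z \<le> real (n - 1) * cmod z"
    using order by (intro mult_right_mono) auto
  with small have "z \<noteq> 1" by auto
  obtain h where h: "reliability_poly G = [:1, -1:] ^ (n - 1) * h" "geometric_growth (n - 1) h"
    using reliability_factorization[OF fin] conn order by (auto simp: connected_multigraph_def)
  have "coeff h 0 = 1"
    using reliability_cofactor_coeff_0[OF _ h(1)] fin conn by (simp add: finite_multigraph_def)
  then have "poly h z \<noteq> 0"
    using geometric_growth_poly_nonzero h small by blast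
  then show False
    using root h \<open>z \<noteq> 1\<close> by (simp add: reliability_root_def poly_mult poly_power)
qed

section \<open>Cycles\<close>

text \<open>
  For \<open>n = 2\<close> the cycle consists of two parallel edges,
  whose reliability \<open>1 - q\<^sup>2\<close> fits the general formula.
\<close>

definition cycle_graph :: "nat \<Rightarrow> (nat, nat) multigraph" where
  "cycle_graph n = \<lparr>verts = {..<n}, edges = {..<n}, ends = (\<lambda>i. Upair i (Suc i mod n))\<rparr>"

lemma cycle_graph_simps [simp]:
  "verts (cycle_graph n) = {..<n}" "edges (cycle_graph n) = {..<n}"
  "ends (cycle_graph n) i = Upair i (Suc i mod n)"
  by (simp_all add: cycle_graph_def)

lemma finite_cycle_graph:
  assumes "n > 0"
  shows "finite_multigraph (cycle_graph n)"
  using assms by (auto simp: finite_multigraph_def)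

lemma connected_cycle_minus_edge:
  assumes "i < n"
  shows "connected_multigraph (spanning_subgraph (cycle_graph n) ({..<n} - {i}))"
    (is "connected_multigraph ?P")
proof -
  have edge: "(j, Suc j mod n) \<in> adj_rel ?P" if "j < n" "j \<noteq> i" for j
    using that by (auto simp: adj_rel_def)
  (* What remains is a path: one arm runs from 0 up to i, the other from i + 1 up to n - 1 and on
     to 0. The index n stands for 0 in the second arm, which allows induction down from n. *)
  have below: "(0, j) \<in> (adj_rel ?P)\<^sup>*" if "j \<le> i" for j
    using that
  proof (induction j)
    case (Suc j)
    then have "(j, Suc j) \<in> adj_rel ?P"
      using edge[of j] assms by simp
    then show ?case using Suc by (simp add: rtrancl_into_rtrancl)
  qed simp
  have above: "(j mod n, 0) \<in> (adj_rel ?P)\<^sup>*" if "i < j" "j \<le> n" for j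
    using that(2,1)
  proof (induction rule: inc_induct)
    case (step j)
    then show ?case
      using edge[of j] by (auto intro: converse_rtrancl_into_rtrancl)
  qed simp
  have sym: "(b, a) \<in> (adj_rel ?P)\<^sup>*" if "(a, b) \<in> (adj_rel ?P)\<^sup>*" for a b
    using that sym_rtrancl[OF sym_adj_rel] by (meson symD)
  have "(j, 0) \<in> (adj_rel ?P)\<^sup>*" if "j < n" for j
    using below[of j] above[of j] sym that by (cases "j \<le> i") auto
  then have "(a, b) \<in> (adj_rel ?P)\<^sup>*" if "a < n" "b < n" for a b
    using that sym by (meson rtrancl_trans)
  then show ?thesis
    using assms by (auto simp: connected_multigraph_def)
qed

text \<open>
  Without the edges \<open>i\<close> and \<open>j\<close> no walk leaves the arc \<open>{i<..j}\<close>.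
\<close>

lemma disconnected_cycle_minus_two_edges:
  assumes ij: "i < j" "j < n" and S: "S \<subseteq> {..<n} - {i, j}"
  shows "\<not> connected_multigraph (spanning_subgraph (cycle_graph n) S)"
    (is "\<not> connected_multigraph ?P")
proof
  define X where "X = {i<..j}"
  assume "connected_multigraph ?P"
  then have "(j, i) \<in> (adj_rel ?P)\<^sup>*"
    using ij by (auto simp: connected_multigraph_def)
  then have "i \<in> X"
  proof induction
    case (step b c)
    from step.hyps(2) obtain g where g: "g \<in> S" "Upair g (Suc g mod n) = Upair b c"
      by (auto simp: adj_rel_def)
    have "g < n" "g \<noteq> i" "g \<noteq> j"
      using g S by auto
    then have "g \<in> X \<longleftrightarrow> Suc g mod n \<in> X"
      unfolding X_def using ij by (cases "Suc g = n") auto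
    then show ?case using g step.IH by auto
  qed (use ij in \<open>auto simp: X_def\<close>)
  then show False by (simp add: X_def)
qed

lemma connected_cycle_iff:
  assumes "n \<ge> 2" "S \<subseteq> {..<n}"
  shows "connected_multigraph (spanning_subgraph (cycle_graph n) S)
    \<longleftrightarrow> S = {..<n} \<or> (\<exists>i<n. S = {..<n} - {i})"
proof
  assume conn: "connected_multigraph (spanning_subgraph (cycle_graph n) S)"
  show "S = {..<n} \<or> (\<exists>i<n. S = {..<n} - {i})"
  proof (rule ccontr)
    assume neg: "\<not> ?thesis"
    then obtain i where i: "i < n" "i \<notin> S" using assms by blast
    with neg assms obtain j where j: "j < n" "j \<notin> S" "j \<noteq> i" by blast
    have "min i j < max i j" "max i j < n" "S \<subseteq> {..<n} - {min i j, max i j}"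
      using i j assms by (auto simp: min_def max_def)
    then show False
      using disconnected_cycle_minus_two_edges conn by blast
  qed
next
  assume "S = {..<n} \<or> (\<exists>i<n. S = {..<n} - {i})"
  then show "connected_multigraph (spanning_subgraph (cycle_graph n) S)"
  proof
    assume "S = {..<n}"
    then show ?thesis
      using connected_mono[OF connected_cycle_minus_edge[of 0 n], of S] assms by auto
  qed (use connected_cycle_minus_edge in auto)
qed

lemma reliability_cycle:
  assumes "n \<ge> 2"
  shows "reliability_poly (cycle_graph n) = [:1, -1:] ^ (n - 1) * [:1, of_nat (n - 1):]"
proof -
  let ?t = "\<lambda>S. [:1, -1:] ^ card S * [:0, 1:] ^ (n - card S) :: complex poly"
  have conn: "{S. S \<subseteq> {..<n} \<and> connected_multigraph (spanning_subgraph (cycle_graph n) S)}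
      = insert {..<n} ((\<lambda>i. {..<n} - {i}) ` {..<n})"
    using connected_cycle_iff[OF assms] by (auto simp: image_iff)
  have inj: "inj_on (\<lambda>i. {..<n} - {i}) {..<n}"
    by (auto intro!: inj_onI)
  have "reliability_poly (cycle_graph n) = ?t {..<n} + (\<Sum>i<n. ?t ({..<n} - {i}))"
    unfolding reliability_poly_def cycle_graph_simps conn card_lessThan
    by (subst sum.insert) (auto simp: sum.reindex[OF inj])
  also have "\<dots> = [:1, -1:] ^ n + of_nat n * ([:1, -1:] ^ (n - 1) * [:0, 1:])"
    using assms by (simp add: card_Diff_singleton)
  also have "\<dots> = [:1, -1:] ^ (n - 1) * ([:1, -1:] + of_nat n * [:0, 1:])"
    using assms by (cases n) (auto simp: algebra_simps simp del: mult_pCons_left mult_pCons_right)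
  also have "[:1, -1:] + of_nat n * [:0, 1:] = [:1, of_nat (n - 1) :: complex:]"
    using assms by (simp add: of_nat_poly of_nat_diff)
  finally show ?thesis .
qed

lemma inverse_order_minus_1_in_root_moduli:
  assumes "n \<ge> 2"
  shows "1 / (real n - 1) \<in> root_moduli n"
proof -
  let ?z = "- (1 / of_nat (n - 1)) :: complex"
  have "reliability_root (cycle_graph n) ?z"
    using assms by (simp add: reliability_root_def reliability_cycle poly_mult)
  moreover have "connected_multigraph (cycle_graph n)"
    using connected_cycle_iff[OF assms, of "{..<n}"] spanning_subgraph_edges by (metis cycle_graph_simps(2) order_refl)
  moreover have "cmod ?z = 1 / (real n - 1)"
    using assms
    by (simp only: norm_minus_cancel norm_divide norm_one norm_of_nat) (simp add: of_nat_diff)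
  ultimately show ?thesis
    using finite_cycle_graph[of n] assms unfolding root_moduli_def graph_order_def
    by (force intro!: exI[of _ ?z] exI[of _ "cycle_graph n"])
qed

theorem theorem2p1:
  fixes n :: nat
  assumes "n \<ge> 2"
  shows "min_root_modulus n = 1 / (real n - 1)
    \<and> 1 / (real n - 1) \<in> root_moduli n
    \<and> (\<forall>r\<in>root_moduli n. 1 / (real n - 1) \<le> r)
    \<and> (\<forall>(G :: ('v, 'e) multigraph) z.
          finite_multigraph G \<and> connected_multigraph G \<and> graph_order G = n \<and> reliability_root G z
            \<longrightarrow> 1 / (real n - 1) \<le> cmod z)"
proof -
  have attained: "1 / (real n - 1) \<in> root_moduli n"
    using assms by (rule inverse_order_minus_1_in_root_moduli)
  have lower: "\<forall>r\<in>root_moduli n. 1 / (real n - 1) \<le> r"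
    using reliability_root_modulus_ge assms by (fastforce simp: root_moduli_def)
  have "min_root_modulus n = 1 / (real n - 1)"
    unfolding min_root_modulus_def by (rule Least_equality) (use attained lower in auto)
  then show ?thesis
    using attained lower reliability_root_modulus_ge assms by blast
qed

end
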